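(* Let $K$ be a field, let $X = \{x_1, x_2, x_3, \ldots\}$, and let $R = K[X]$. Let $n$ be a positive integer, let $G = \{g_1, \ldots, g_n\}$ be a set of monomials of $R$, all of degree $d$, with (pairwise) distinct types, and fix a matrix $C = (c_{ij}) \in K^{n \times n}$ of rank $r$. Then the $R[\mathfrak{S}_\infty]$-submodule $I = \langle f_1, \ldots, f_n \rangle_{R[\mathfrak{S}_\infty]} \subseteq R$ generated by the $n$ polynomials $$f_j = \sum_{i=1}^{n} c_{ij}\, g_i, \qquad j = 1, \ldots, n,$$ cannot be generated as an $R[\mathfrak{S}_\infty]$-module by fewer than $r$ polynomials.
   Context: $\mathfrak{S}_\infty$ denotes the group of all permutations of the positive integers; it acts on $R = K[x_1, x_2, \ldots]$ by $K$-algebra automorphisms with $\sigma x_i = x_{\sigma i}$ for $\sigma \in \mathfrak{S}_\infty$. $R[\mathfrak{S}_\infty]$ denotes the (left) group ring of $\mathfrak{S}_\infty$ over $R$, whose elements are finite formal sums $\sum_\sigma s_\sigma \sigma$ with $s_\sigma \in R$ and $\sigma \in \mathfrak{S}_\infty$; it acts naturally on $R$ by $\left(\sum_\sigma s_\sigma \sigma\right) f = \sum_\sigma s_\sigma\, \sigma(f)$. The $R[\mathfrak{S}_\infty]$-submodule $\langle p_1,\ldots,p_k\rangle_{R[\mathfrak{S}_\infty]}$ generated by $p_1, \ldots, p_k \in R$ is the smallest $R[\mathfrak{S}_\infty]$-submodule of $R$ containing them, i.e. the ideal of $R$ generated by all $\sigma(p_l)$ with $\sigma \in \mathfrak{S}_\infty$,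 $1 \le l \le k$. Type of a monomial: let $M$ be a finite multiset of positive integers with distinct elements $i_1, \ldots, i_k$ arranged so that $m(i_1) \geq \cdots \geq m(i_k)$, where $m(i_j)$ is the multiplicity of $i_j$ in $M$. The type of $M$ is the vector $\lambda(M) = (m(i_1), m(i_2), \ldots, m(i_k))$. Multisets correspond bijectively to monomials (with coefficient $1$) of $K[X]$ via $M \mapsto \prod_{j=1}^k x_{i_j}^{m(i_j)}$, and the type of a monomial is the type of the corresponding multiset (that is, its list of nonzero exponents sorted in weakly decreasing order). The degree of a monomial is its total degree. *)

theory Defs
  imports "HOL-Analysis.Analysis" "HOL-Library.Poly_Mapping" "HOL-Library.Multiset"
begin

text \<open>
  Variables are indexed by the natural numbers, so that index \<open>i\<close> stands for the variable
  usually called \<open>x\<close> with index \<open>i + 1\<close>.  A monomial is represented by its finitely supported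
  exponent function (equivalently, by a finite multiset of indices), and a polynomial by its
  finitely supported coefficient function; the product of the latter type is convolution.
\<close>

type_synonym monomial = "nat \<Rightarrow>\<^sub>0 nat"

type_synonym 'k mpoly = "(nat \<Rightarrow>\<^sub>0 nat) \<Rightarrow>\<^sub>0 'k"

definition const_poly :: "'k::field \<Rightarrow> 'k mpoly"
  where "const_poly c = Poly_Mapping.single 0 c"

definition monomial_poly :: "monomial \<Rightarrow> 'k::field mpoly"
  where "monomial_poly m = Poly_Mapping.single m 1"

definition var :: "nat \<Rightarrow> 'k::field mpoly"
  where "var i = monomial_poly (Poly_Mapping.single i 1)"

definition monomial_degree :: "monomial \<Rightarrow> nat"
  where "monomial_degree m = (\<Sum>i\<in>Poly_Mapping.keys m. Poly_Mapping.lookup m i)"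

definition monomial_type :: "monomial \<Rightarrow> nat list"
  where "monomial_type m =
    rev (sorted_list_of_multiset
      (image_mset (Poly_Mapping.lookup m) (mset_set (Poly_Mapping.keys m))))"

text \<open>
  The action of a permutation on polynomials.  The definitions are total; they are only used for
  bijective arguments.
\<close>

definition act_monomial :: "(nat \<Rightarrow> nat) \<Rightarrow> monomial \<Rightarrow> monomial"
  where "act_monomial \<sigma> m =
    (\<Sum>i\<in>Poly_Mapping.keys m. Poly_Mapping.single (\<sigma> i) (Poly_Mapping.lookup m i))"

definition act_poly :: "(nat \<Rightarrow> nat) \<Rightarrow> 'k::field mpoly \<Rightarrow> 'k mpoly"
  where "act_poly \<sigma> p =
    (\<Sum>m\<in>Poly_Mapping.keys p. Poly_Mapping.single (act_monomial \<sigma> m) (Poly_Mapping.lookup p m))"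

text \<open>
  Elements of the group ring are the formal sums of (arbitrary, not necessarily finitely
  supported) permutations with polynomial coefficients.  Only their action is needed to speak
  about submodules.
\<close>

definition group_ring :: "((nat \<Rightarrow> nat) \<Rightarrow>\<^sub>0 'k::field mpoly) set"
  where "group_ring = {u. \<forall>\<sigma>\<in>Poly_Mapping.keys u. bij \<sigma>}"

definition group_ring_act :: "((nat \<Rightarrow> nat) \<Rightarrow>\<^sub>0 'k::field mpoly) \<Rightarrow> 'k mpoly \<Rightarrow> 'k mpoly"
  where "group_ring_act u f =
    (\<Sum>\<sigma>\<in>Poly_Mapping.keys u. Poly_Mapping.lookup u \<sigma> * act_poly \<sigma> f)"

definition sym_submodule :: "'k::field mpoly set \<Rightarrow> bool"
  where "sym_submodule M \<longleftrightarrow>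
    0 \<in> M \<and>
    (\<forall>f\<in>M. \<forall>g\<in>M. f + g \<in> M) \<and>
    (\<forall>u\<in>group_ring. \<forall>f\<in>M. group_ring_act u f \<in> M)"

definition generated_submodule :: "'k::field mpoly set \<Rightarrow> 'k mpoly set"
  where "generated_submodule S = sym_submodule hull S"

text \<open>
  Sanity checks: \<open>act_poly \<sigma>\<close> is the algebra endomorphism sending the variable with index \<open>i\<close>
  to the one with index \<open>\<sigma> i\<close>, the identity and composition of functions act as they should,
  and generated submodules are submodules.
\<close>

lemma act_monomial_superset:
  assumes "finite A" "Poly_Mapping.keys m \<subseteq> A"
  shows "act_monomial \<sigma> m = (\<Sum>i\<in>A. Poly_Mapping.single (\<sigma> i) (Poly_Mapping.lookup m i))"
  unfolding act_monomial_def
  by (rule sum.mono_neutral_left) (use assms in \<open>auto simp: in_keys_iff\<close>)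

lemma act_poly_superset:
  assumes "finite A" "Poly_Mapping.keys p \<subseteq> A"
  shows "act_poly \<sigma> p =
    (\<Sum>m\<in>A. Poly_Mapping.single (act_monomial \<sigma> m) (Poly_Mapping.lookup p m))"
  unfolding act_poly_def
  by (rule sum.mono_neutral_left) (use assms in \<open>auto simp: in_keys_iff\<close>)

lemma act_monomial_zero [simp]: "act_monomial \<sigma> 0 = 0"
  by (simp add: act_monomial_def)

lemma act_monomial_single [simp]:
  "act_monomial \<sigma> (Poly_Mapping.single i k) = Poly_Mapping.single (\<sigma> i) k"
  by (subst act_monomial_superset[of "{i}"]) auto

lemma act_monomial_add: "act_monomial \<sigma> (m + m') = act_monomial \<sigma> m + act_monomial \<sigma> m'"
proof -
  let ?A = "Poly_Mapping.keys m \<union> Poly_Mapping.keys m'"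
  show ?thesis
    by (simp add: act_monomial_superset[of ?A] Poly_Mapping.keys_add lookup_add single_add
        sum.distrib)
qed

lemma act_poly_zero [simp]: "act_poly \<sigma> 0 = 0"
  by (simp add: act_poly_def)

lemma act_poly_single [simp]:
  "act_poly \<sigma> (Poly_Mapping.single m c) = Poly_Mapping.single (act_monomial \<sigma> m) c"
  by (subst act_poly_superset[of "{m}"]) auto

lemma act_poly_var: "act_poly \<sigma> (var i) = var (\<sigma> i)"
  by (simp add: var_def monomial_poly_def)

lemma act_poly_const: "act_poly \<sigma> (const_poly c) = const_poly c"
  by (simp add: const_poly_def)

lemma act_poly_add: "act_poly \<sigma> (p + q) = act_poly \<sigma> p + act_poly \<sigma> q"
proof -
  let ?A = "Poly_Mapping.keys p \<union> Poly_Mapping.keys q"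
  show ?thesis
    by (simp add: act_poly_superset[of ?A] Poly_Mapping.keys_add lookup_add single_add
        sum.distrib)
qed

lemma act_poly_sum: "act_poly \<sigma> (sum f A) = (\<Sum>a\<in>A. act_poly \<sigma> (f a))"
  by (induction A rule: infinite_finite_induct) (auto simp: act_poly_add)

lemma sum_single_lookup:
  "(\<Sum>k\<in>Poly_Mapping.keys p. Poly_Mapping.single k (Poly_Mapping.lookup p k)) = p"
  by (rule poly_mapping_eqI)
    (auto simp: lookup_sum lookup_single when_def in_keys_iff)

lemma act_poly_mult: "act_poly \<sigma> (p * q) = act_poly \<sigma> p * act_poly \<sigma> q"
proof -
  have "p * q = (\<Sum>m\<in>Poly_Mapping.keys p. Poly_Mapping.single m (Poly_Mapping.lookup p m))
      * (\<Sum>m\<in>Poly_Mapping.keys q. Poly_Mapping.single m (Poly_Mapping.lookup q m))"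
    by (simp only: sum_single_lookup)
  then show ?thesis
    by (simp add: sum_product mult_single act_poly_sum act_monomial_add
        act_poly_def[of _ p] act_poly_def[of _ q])
qed

lemma act_monomial_sum: "act_monomial \<sigma> (sum f A) = (\<Sum>a\<in>A. act_monomial \<sigma> (f a))"
  by (induction A rule: infinite_finite_induct) (auto simp: act_monomial_add)

lemma act_monomial_id [simp]: "act_monomial id m = m"
  by (simp add: act_monomial_def sum_single_lookup)

lemma act_monomial_comp: "act_monomial (\<sigma> \<circ> \<tau>) m = act_monomial \<sigma> (act_monomial \<tau> m)"
  by (simp add: act_monomial_def[of \<tau>] act_monomial_def[of "\<sigma> \<circ> \<tau>"] act_monomial_sum)

lemma act_poly_id: "act_poly id p = p"
  by (simp add: act_poly_def sum_single_lookup)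

lemma act_poly_comp: "act_poly (\<sigma> \<circ> \<tau>) p = act_poly \<sigma> (act_poly \<tau> p)"
  by (simp add: act_poly_def[of \<tau>] act_poly_def[of "\<sigma> \<circ> \<tau>"] act_poly_sum act_monomial_comp)

lemma sym_submodule_generated: "sym_submodule (generated_submodule S)"
  unfolding generated_submodule_def
  by (rule hull_in) (auto simp: sym_submodule_def)

end

theory Submission
  imports Defs
begin

text \<open>
  The idea is to look at the module only in its lowest degree, and there only up to the symmetry.
  For a type \<open>t\<close> let \<open>type_coefficient t p\<close> be the sum of the coefficients of \<open>p\<close> at all monomials
  of type \<open>t\<close>.  Permuting the variables preserves types, so these sums are invariant under the
  group.  If moreover \<open>p\<close> has no monomials of degree less than \<open>d\<close> and \<open>t\<close> is a type of degree
  \<open>d\<close>, then a product \<open>s * p\<close> contains monomials of type \<open>t\<close> only through the constant term of \<open>s\<close>,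
  and the sum is just multiplied by this constant (\<open>type_coefficient_mult\<close>).

  The sums for the types of \<open>g\<^sub>1, \<dots>, g\<^sub>n\<close> together form a vector in \<open>K\<^sup>n\<close>, and on the vectors of
  polynomials of order at least \<open>d\<close> the group ring acts through scalars.  So for every subspace \<open>V\<close> of \<open>K\<^sup>n\<close> the
  polynomials of order at least \<open>d\<close> whose vector lies in \<open>V\<close> form a submodule
  (\<open>sym_submodule_type_vector\<close>).  Taking for \<open>V\<close> the span of the vectors of a generating set \<open>S\<close> of
  \<open>I\<close>, all vectors of elements of \<open>I\<close> lie in a space spanned by \<open>card S\<close> vectors.  But because the
  types are distinct, the vector of \<open>f\<^sub>j\<close> is the \<open>j\<close>-th column of \<open>C\<close>, so these span a space of
  dimension \<open>r\<close>.
\<close>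

section \<open>Degrees and types of monomials\<close>

lemma monomial_degree_superset:
  assumes "finite A" "Poly_Mapping.keys m \<subseteq> A"
  shows "monomial_degree m = (\<Sum>i\<in>A. Poly_Mapping.lookup m i)"
  unfolding monomial_degree_def
  by (rule sum.mono_neutral_left) (use assms in \<open>auto simp: in_keys_iff\<close>)

lemma monomial_degree_add: "monomial_degree (m + m') = monomial_degree m + monomial_degree m'"
proof -
  let ?A = "Poly_Mapping.keys m \<union> Poly_Mapping.keys m'"
  show ?thesis
    by (simp add: monomial_degree_superset[of ?A] Poly_Mapping.keys_add lookup_add sum.distrib)
qed

lemma monomial_degree_eq_0_iff [simp]: "monomial_degree m = 0 \<longleftrightarrow> m = 0"
  by (auto simp: monomial_degree_def in_keys_iff intro!: poly_mapping_eqI)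

lemma sum_list_monomial_type: "sum_list (monomial_type m) = monomial_degree m"
proof -
  have "sum_list (monomial_type m) = sum_mset (mset (monomial_type m))"
    by (simp only: sum_mset_sum_list)
  also have "\<dots> = monomial_degree m"
    by (simp add: monomial_type_def monomial_degree_def sum_unfold_sum_mset)
  finally show ?thesis .
qed

lemma lookup_act_monomial:
  assumes "bij \<sigma>"
  shows "Poly_Mapping.lookup (act_monomial \<sigma> m) (\<sigma> i) = Poly_Mapping.lookup m i"
  using bij_is_inj[OF assms]
  by (auto simp: act_monomial_def lookup_sum lookup_single when_def inj_eq in_keys_iff)

lemma keys_act_monomial:
  assumes "bij \<sigma>"
  shows "Poly_Mapping.keys (act_monomial \<sigma> m) = \<sigma> ` Poly_Mapping.keys m"
proof (rule set_eqI)
  fix k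
  obtain i where "k = \<sigma> i"
    using assms by (metis bij_pointE)
  then show "k \<in> Poly_Mapping.keys (act_monomial \<sigma> m) \<longleftrightarrow> k \<in> \<sigma> ` Poly_Mapping.keys m"
    using bij_is_inj[OF assms]
    by (auto simp: in_keys_iff lookup_act_monomial[OF assms] inj_eq)
qed

lemma monomial_type_act_monomial:
  assumes "bij \<sigma>"
  shows "monomial_type (act_monomial \<sigma> m) = monomial_type m"
proof -
  have "mset_set (\<sigma> ` Poly_Mapping.keys m) = image_mset \<sigma> (mset_set (Poly_Mapping.keys m))"
    by (rule image_mset_mset_set[symmetric]) (use assms in \<open>auto simp: bij_def inj_on_def\<close>)
  then show ?thesis
    by (simp add: monomial_type_def keys_act_monomial[OF assms] multiset.map_comp o_def
        lookup_act_monomial[OF assms])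
qed

lemma monomial_degree_act_monomial:
  "bij \<sigma> \<Longrightarrow> monomial_degree (act_monomial \<sigma> m) = monomial_degree m"
  by (simp add: monomial_type_act_monomial flip: sum_list_monomial_type)

section \<open>Coefficient sums over all monomials of a type\<close>

definition type_coefficient :: "nat list \<Rightarrow> 'k::field mpoly \<Rightarrow> 'k"
  where "type_coefficient t p =
    (\<Sum>m\<in>Poly_Mapping.keys p. Poly_Mapping.lookup p m when monomial_type m = t)"

lemma type_coefficient_superset:
  assumes "finite A" "Poly_Mapping.keys p \<subseteq> A"
  shows "type_coefficient t p = (\<Sum>m\<in>A. Poly_Mapping.lookup p m when monomial_type m = t)"
  unfolding type_coefficient_def
  by (rule sum.mono_neutral_left) (use assms in \<open>auto simp: in_keys_iff\<close>)

lemma type_coefficient_zero [simp]: "type_coefficient t 0 = 0"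
  by (simp add: type_coefficient_def)

lemma type_coefficient_single [simp]:
  "type_coefficient t (Poly_Mapping.single m c) = (c when monomial_type m = t)"
  by (subst type_coefficient_superset[of "{m}"]) auto

lemma type_coefficient_add:
  "type_coefficient t (p + q) = type_coefficient t p + type_coefficient t q"
proof -
  let ?A = "Poly_Mapping.keys p \<union> Poly_Mapping.keys q"
  show ?thesis
    by (simp add: type_coefficient_superset[of ?A] Poly_Mapping.keys_add lookup_add when_add_distrib
        sum.distrib)
qed

lemma type_coefficient_sum:
  "type_coefficient t (sum p A) = (\<Sum>a\<in>A. type_coefficient t (p a))"
  by (induction A rule: infinite_finite_induct) (auto simp: type_coefficient_add)

lemma type_coefficient_act_poly:
  assumes "bij \<sigma>"
  shows "type_coefficient t (act_poly \<sigma> p) = type_coefficient t p"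
  by (simp add: act_poly_def type_coefficient_sum monomial_type_act_monomial[OF assms])
    (simp add: type_coefficient_def)

definition order_at_least :: "nat \<Rightarrow> 'k::field mpoly \<Rightarrow> bool"
  where "order_at_least d p \<longleftrightarrow> (\<forall>m\<in>Poly_Mapping.keys p. d \<le> monomial_degree m)"

lemma order_at_least_zero [simp]: "order_at_least d 0"
  by (simp add: order_at_least_def)

lemma order_at_least_add:
  "order_at_least d p \<Longrightarrow> order_at_least d q \<Longrightarrow> order_at_least d (p + q)"
  using Poly_Mapping.keys_add[of p q] by (auto simp: order_at_least_def)

lemma order_at_least_sum:
  "(\<And>a. a \<in> A \<Longrightarrow> order_at_least d (p a)) \<Longrightarrow> order_at_least d (sum p A)"
  by (induction A rule: infinite_finite_induct) (auto intro: order_at_least_add)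

lemma order_at_least_mult:
  assumes "order_at_least d p"
  shows "order_at_least d (s * p)"
proof -
  have "d \<le> monomial_degree (a + b)" if "b \<in> Poly_Mapping.keys p" for a b
    using that assms by (auto simp: order_at_least_def monomial_degree_add intro: trans_le_add2)
  then show ?thesis
    using keys_mult[of s p] by (fastforce simp: order_at_least_def)
qed

lemma order_at_least_act_poly:
  assumes "bij \<sigma>" "order_at_least d p"
  shows "order_at_least d (act_poly \<sigma> p)"
  unfolding act_poly_def
  by (rule order_at_least_sum)
    (use assms in \<open>auto simp: order_at_least_def monomial_degree_act_monomial\<close>)

text \<open>
  A product of a nonconstant monomial with a monomial of degree at least \<open>d\<close> has degree larger
  than \<open>d\<close>, hence is not of type \<open>t\<close>.  Therefore only the constant term of \<open>s\<close> contributes.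
\<close>

lemma type_coefficient_mult:
  assumes "order_at_least d p" "sum_list t = d"
  shows "type_coefficient t (s * p) = Poly_Mapping.lookup s 0 * type_coefficient t p"
proof -
  let ?s = "Poly_Mapping.lookup s" and ?p = "Poly_Mapping.lookup p"
  have high: "monomial_type (a + b) \<noteq> t" if "b \<in> Poly_Mapping.keys p" "a \<noteq> 0" for a b
  proof
    assume "monomial_type (a + b) = t"
    then have "monomial_degree a + monomial_degree b = d"
      using assms(2) by (metis sum_list_monomial_type monomial_degree_add)
    moreover have "d \<le> monomial_degree b"
      using assms(1) that by (auto simp: order_at_least_def)
    ultimately have "monomial_degree a = 0"
      by linarith
    with that(2) show False
      by simp
  qed
  have "s * p = (\<Sum>a\<in>Poly_Mapping.keys s. Poly_Mapping.single a (?s a))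
      * (\<Sum>b\<in>Poly_Mapping.keys p. Poly_Mapping.single b (?p b))"
    by (simp only: sum_single_lookup)
  then have "type_coefficient t (s * p) =
      (\<Sum>a\<in>Poly_Mapping.keys s. \<Sum>b\<in>Poly_Mapping.keys p. ?s a * ?p b when monomial_type (a + b) = t)"
    by (simp add: sum_product mult_single type_coefficient_sum)
  also have "\<dots> = (\<Sum>a\<in>Poly_Mapping.keys s. if a = 0 then ?s 0 * type_coefficient t p else 0)"
    by (rule sum.cong[OF refl])
      (auto simp: high type_coefficient_def sum_distrib_left mult_when intro!: sum.neutral sum.cong)
  also have "\<dots> = ?s 0 * type_coefficient t p"
    by (simp add: in_keys_iff)
  finally show ?thesis .
qed

section \<open>Submodules cut out by coefficient sums\<close>

definition type_vector :: "('n \<Rightarrow> nat list) \<Rightarrow> 'k::field mpoly \<Rightarrow> 'k ^ 'n::finite"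
  where "type_vector t p = (\<chi> i. type_coefficient (t i) p)"

lemma type_vector_zero [simp]: "type_vector t 0 = 0"
  by (simp add: type_vector_def vec_eq_iff)

lemma type_vector_add: "type_vector t (p + q) = type_vector t p + type_vector t q"
  by (simp add: type_vector_def vec_eq_iff type_coefficient_add)

lemma type_vector_act_poly: "bij \<sigma> \<Longrightarrow> type_vector t (act_poly \<sigma> p) = type_vector t p"
  by (simp add: type_vector_def type_coefficient_act_poly)

lemma type_vector_mult:
  assumes "\<And>i. sum_list (t i) = d" "order_at_least d p"
  shows "type_vector t (s * p) = Poly_Mapping.lookup s 0 *s type_vector t p"
  using assms by (simp add: type_vector_def vec_eq_iff type_coefficient_mult)

lemma sym_submoduleI:
  assumes zero: "0 \<in> M"
    and add: "\<And>p q. p \<in> M \<Longrightarrow> q \<in> M \<Longrightarrow> p + q \<in> M"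
    and mult: "\<And>s p. p \<in> M \<Longrightarrow> s * p \<in> M"
    and act: "\<And>\<sigma> p. bij \<sigma> \<Longrightarrow> p \<in> M \<Longrightarrow> act_poly \<sigma> p \<in> M"
  shows "sym_submodule M"
proof -
  have sum: "sum h A \<in> M" if "\<And>a. a \<in> A \<Longrightarrow> h a \<in> M" for h :: "(nat \<Rightarrow> nat) \<Rightarrow> _" and A
    using that by (induction A rule: infinite_finite_induct) (auto intro: zero add)
  show ?thesis
    by (auto simp: sym_submodule_def group_ring_def group_ring_act_def intro!: zero add sum mult act)
qed

lemma sym_submodule_type_vector:
  assumes "\<And>i. sum_list (t i) = d" "vec.subspace V"
  shows "sym_submodule {p. order_at_least d p \<and> type_vector t p \<in> V}"
  by (rule sym_submoduleI)
    (auto simp: type_vector_add type_vector_act_poly type_vector_mult[OF assms(1)]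
      intro: order_at_least_add order_at_least_mult order_at_least_act_poly
        vec.subspace_0[OF assms(2)] vec.subspace_add[OF assms(2)] vec.subspace_scale[OF assms(2)])

lemma type_vector_generated_submodule:
  assumes types: "\<And>i. sum_list (t i) = d"
    and order: "\<And>p. p \<in> S \<Longrightarrow> order_at_least d p"
    and p: "p \<in> generated_submodule S"
  shows "order_at_least d p" "type_vector t p \<in> vec.span (type_vector t ` S)"
proof -
  let ?V = "vec.span (type_vector t ` S)"
  have "generated_submodule S \<subseteq> {p. order_at_least d p \<and> type_vector t p \<in> ?V}"
    unfolding generated_submodule_def
    by (rule hull_minimal)
      (auto simp: order intro: vec.span_base sym_submodule_type_vector[OF types vec.subspace_span])
  with p show "order_at_least d p" "type_vector t p \<in> ?V"
    by auto
qed

lemma generated_submodule_superset: "S \<subseteq> generated_submodule S"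
  by (simp add: generated_submodule_def hull_subset)

section \<open>Rank and the span of the columns\<close>

text \<open>
  The rank is the dimension of the row space.  Writing the columns as combinations of the
  vectors in \<open>T\<close> factors the matrix through a space with coordinates indexed by \<open>T\<close>, and then
  every row is a combination of the \<open>card T\<close> rows of the second factor.
\<close>

lemma rank_le_card_column_span:
  fixes C :: "'k::field ^ 'n ^ 'm"
  assumes "finite T" and cols: "\<And>j. column j C \<in> vec.span T"
  shows "rank C \<le> card T"
proof -
  have "\<exists>a. column j C = (\<Sum>v\<in>T. a v *s v)" for j
    using cols[of j] by (auto simp: vec.span_finite[OF assms(1)])
  then obtain a where a: "\<And>j. column j C = (\<Sum>v\<in>T. a j v *s v)"
    by metis
  let ?w = "\<lambda>v. \<chi> j. a j v"
  have "row i C = (\<Sum>v\<in>T. v $ i *s ?w v)" for i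
  proof -
    have "C $ i $ j = (\<Sum>v\<in>T. v $ i * a j v)" for j
      using arg_cong[OF a[of j], of "\<lambda>v. v $ i"] by (simp add: column_def mult.commute)
    then show ?thesis
      by (simp add: row_def vec_eq_iff)
  qed
  then have "rows C \<subseteq> vec.span (?w ` T)"
    by (auto simp: rows_def intro!: vec.span_sum vec.span_scale intro: vec.span_base)
  then have "vec.dim (rows C) \<le> card (?w ` T)"
    by (rule vec.dim_le_card) (simp add: assms(1))
  also have "\<dots> \<le> card T"
    by (rule card_image_le[OF assms(1)])
  finally show ?thesis
    by (simp add: row_rank_def_gen)
qed

section \<open>The lower bound for the number of generators\<close>

theorem theorem3:
  fixes g :: "'n::finite \<Rightarrow> monomial"
    and d :: nat
    and C :: "'k::field ^ 'n ^ 'n"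
    and r :: nat
    and f :: "'n \<Rightarrow> 'k mpoly"
    and I :: "'k mpoly set"
  assumes "\<And>i. monomial_degree (g i) = d"
    and "\<And>i j. i \<noteq> j \<Longrightarrow> monomial_type (g i) \<noteq> monomial_type (g j)"
    and "rank C = r"
    and "\<And>j. f j = (\<Sum>i\<in>UNIV. const_poly (C $ i $ j) * monomial_poly (g i))"
    and "I = generated_submodule (range f)"
  shows "\<not> (\<exists>S. finite S \<and> card S < r \<and> I = generated_submodule S)"
proof
  let ?t = "\<lambda>i. monomial_type (g i)"
  assume "\<exists>S. finite S \<and> card S < r \<and> I = generated_submodule S"
  then obtain S where S: "finite S" "card S < r" "I = generated_submodule S"
    by blast
  have types: "sum_list (?t i) = d" for i
    by (simp add: sum_list_monomial_type assms(1))
  have f_single: "f j = (\<Sum>i\<in>UNIV. Poly_Mapping.single (g i) (C $ i $ j))" for j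
    by (simp add: assms(4) const_poly_def monomial_poly_def mult_single)
  have order_f: "order_at_least d (f j)" for j
    unfolding f_single by (rule order_at_least_sum) (simp add: order_at_least_def assms(1))
  have vector_f: "type_vector ?t (f j) = column j C" for j
  proof -
    have "type_coefficient (?t i) (f j) = C $ i $ j" for i
    proof -
      have "type_coefficient (?t i) (f j) = (\<Sum>k\<in>UNIV. C $ k $ j when ?t k = ?t i)"
        by (simp add: f_single type_coefficient_sum)
      also have "\<dots> = (\<Sum>k\<in>UNIV. if k = i then C $ k $ j else 0)"
        by (rule sum.cong) (use assms(2) in \<open>auto simp: when_def\<close>)
      finally show ?thesis
        by simp
    qed
    then show ?thesis
      by (simp add: type_vector_def column_def vec_eq_iff)
  qed
  \<comment> \<open>Nothing is assumed about the polynomials in \<open>S\<close> individually; that they have no terms of low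
    degree follows only from their lying in the module generated by the homogeneous \<open>f j\<close>.\<close>
  have order_S: "order_at_least d p" if "p \<in> S" for p
  proof -
    have "p \<in> generated_submodule (range f)"
      using that generated_submodule_superset[of S] S(3) assms(5) by blast
    then show ?thesis
      using type_vector_generated_submodule(1)[of ?t, OF types] order_f by blast
  qed
  have "column j C \<in> vec.span (type_vector ?t ` S)" for j
  proof -
    have "f j \<in> generated_submodule S"
      using generated_submodule_superset[of "range f"] S(3) assms(5) by blast
    from type_vector_generated_submodule(2)[of ?t, OF types order_S this] show ?thesis
      by (simp add: vector_f)
  qed
  then have "rank C \<le> card (type_vector ?t ` S)"
    by (intro rank_le_card_column_span) (simp_all add: S(1))
  also have "\<dots> \<le> card S"
    by (rule card_image_le[OF S(1)])
  finally show False
    using S(2) assms(3) by simp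
qed

end
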